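(* Let $(\tilde{B},\tilde{\nabla}=\nabla^{\tilde{g}}+\mathbb{K},\tilde{g},J)$ be a holomorphic statistical manifold, let $\overline{B}=\tilde{B}\times\mathbb{R}$ with $\overline{g}=e^{2\alpha}\tilde{g}+(d\alpha)^2$, $\xi=\partial/\partial\alpha$, $\phi|_{T\tilde{B}}=J$, $\phi\xi=0$, and let $(\overline{B},\overline{\nabla}=\nabla^{\overline{g}}+\overline{\mathbb{K}},\overline{g},\phi,\xi)$ be the Kenmotsu statistical manifold in which $\mathbb{K}=0$ and $\overline{\mathbb{K}}(X,Y)=\beta\,\overline{g}(X,\xi)\overline{g}(Y,\xi)\xi$ for all $X,Y\in\Gamma(T\overline{B})$, for some $\beta\in C^\infty(\overline{B})$. If $\overline{B}$ is of constant $\phi$-sectional curvature $\overline{c}$ and $\dim\overline{B}=2s+1$, then the Ricci tensor $\overline{Ric}$ of $\overline{B}$ satisfies, for all $X,Y\in\Gamma(T\overline{B})$: (1) $\overline{Ric}(X,Y)=t_1\,\overline{g}(X,Y)+t_2\,\overline{g}(X,\xi)\overline{g}(Y,\xi)$, where $t_1=\frac{\overline{c}(s+1)-3s+1}{2}$ and $t_2=\frac{-(\overline{c}+1)(s+1)}{2}$. Moreover, $\overline{B}$ is not a Ricci-flat statistical manifold. (2) $\overline{Ric}(X,\xi)=-2s\,\overline{g}(X,\xi)$. (3) $\overline{Ric}(\phi X,\phi Y)=\overline{Ric}(X,Y)+2s\,\overline{g}(X,\xi)\overline{g}(Y,\xi)$.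
   Context: A statistical manifold $(M,\nabla,g)$ is a Riemannian manifold with a torsion-free affine connection $\nabla$ such that $\nabla g$ is totally symmetric. Write $\nabla=\nabla^g+\mathbb{K}$ with $\nabla^g$ the Levi-Civita connection. Its statistical curvature tensor is $S(X,Y)Z=R^g(X,Y)Z+[\mathbb{K}_X,\mathbb{K}_Y]Z$, where $R^g(X,Y)Z=\nabla^g_X\nabla^g_YZ-\nabla^g_Y\nabla^g_XZ-\nabla^g_{[X,Y]}Z$. The Ricci tensor is $Ric(Y,Z)=\mathrm{trace}\{X\mapsto S(X,Y)Z\}$. A statistical manifold is Ricci-flat if its Ricci curvature vanishes. A holomorphic statistical manifold $(\tilde{B},\tilde{\nabla}=\nabla^{\tilde g}+\mathbb{K},\tilde{g},J)$ is a Kähler manifold $(\tilde{B},\tilde{g},J)$ with a statistical structure $(\tilde\nabla,\tilde g)$ such that $\mathbb{K}(X,JY)=-J\mathbb{K}(X,Y)$ for all $X,Y$. A Kenmotsu manifold $(\overline{B},\overline{g},\phi,\xi)$ is an almost contact metric manifold with $(\nabla^{\overline{g}}_X\phi)Y=\overline{g}(\phi X,Y)\xi-\overline{g}(Y,\xi)\phi X$ and $\nabla^{\overline{g}}_X\xi=X-\overline{g}(X,\xi)\xi$. A Kenmotsu statistical manifold is a Kenmotsu manifold with a statistical structure $(\nabla^{\overline{g}}+\overline{\mathbb{K}},\overline{g})$ satisfying $\overline{\mathbb{K}}(X,\phi Y)=-\phi\overline{\mathbb{K}}(X,Y)$. The product described in the claim is a Kenmotsu statistical manifold. A Kenmotsu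 statistical manifold with statistical curvature tensor $\overline{S}$ is of constant $\phi$-sectional curvature $\overline{c}$ if $$\overline{S}(X,Y)Z=\tfrac{\overline{c}-3}{4}\{\overline{g}(Y,Z)X-\overline{g}(X,Z)Y\}+\tfrac{\overline{c}+1}{4}\{\overline{g}(\phi Y,Z)\phi X-\overline{g}(\phi X,Z)\phi Y-2\overline{g}(\phi X,Y)\phi Z-\overline{g}(Y,\xi)\overline{g}(Z,\xi)X+\overline{g}(X,\xi)\overline{g}(Z,\xi)Y+\overline{g}(Y,\xi)\overline{g}(Z,X)\xi-\overline{g}(X,\xi)\overline{g}(Z,Y)\xi\}.$$ Here $s\geq 1$ is an integer, with $\dim\tilde{B}=2s$. *)

theory Defs
  imports "HOL-Analysis.Analysis"
begin

section \<open>Smooth maps between open subsets of normed spaces\<close>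

text \<open>
  \<open>Ck_on k f S\<close> is meant for open \<open>S\<close> in a finite-dimensional space, where continuity
  of all iterated directional derivatives is the usual notion of a \<open>C\<^sup>k\<close> map.
\<close>

primrec Ck_on :: "nat \<Rightarrow> ('a::real_normed_vector \<Rightarrow> 'b::real_normed_vector) \<Rightarrow> 'a set \<Rightarrow> bool" where
  "Ck_on 0 f S \<longleftrightarrow> continuous_on S f"
| "Ck_on (Suc k) f S \<longleftrightarrow>
     f differentiable_on S \<and> (\<forall>v. Ck_on k (\<lambda>x. frechet_derivative f (at x) v) S)"

definition smooth_on :: "('a::real_normed_vector \<Rightarrow> 'b::real_normed_vector) \<Rightarrow> 'a set \<Rightarrow> bool" where
  "smooth_on f S \<longleftrightarrow> (\<forall>k. Ck_on k f S)"

section \<open>Smooth manifolds\<close>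

text \<open>
  A chart is a pair of its domain and its coordinate map into the model space \<open>'e\<close>; the
  values of the map outside the domain are irrelevant.
\<close>

type_synonym ('m, 'e) chart = "'m set \<times> ('m \<Rightarrow> 'e)"

abbreviation chart_dom :: "('m, 'e) chart \<Rightarrow> 'm set" where
  "chart_dom c \<equiv> fst c"

abbreviation chart_map :: "('m, 'e) chart \<Rightarrow> 'm \<Rightarrow> 'e" where
  "chart_map c \<equiv> snd c"

abbreviation chart_image :: "('m, 'e) chart \<Rightarrow> 'e set" where
  "chart_image c \<equiv> chart_map c ` chart_dom c"

abbreviation chart_inv :: "('m, 'e) chart \<Rightarrow> 'e \<Rightarrow> 'm" where
  "chart_inv c \<equiv> inv_into (chart_dom c) (chart_map c)"

definition transition :: "('m, 'e) chart \<Rightarrow> ('m, 'e) chart \<Rightarrow> 'e \<Rightarrow> 'e" where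
  "transition c d = chart_map d \<circ> chart_inv c"

text \<open>
  Besides an atlas, a manifold carries a preferred chart around each point \<open>p\<close>. It
  identifies the tangent space at \<open>p\<close> with the model space \<open>'e\<close>: a tangent vector at
  \<open>p\<close> is given by its components with respect to \<open>chart_at M p\<close>. The preferred chart
  may jump as \<open>p\<close> varies, so smoothness of a vector field must be (and is) tested after
  passing to the components in a fixed chart.
\<close>

record ('m, 'e) manifold =
  atlas :: "('m, 'e) chart set"
  chart_at :: "'m \<Rightarrow> ('m, 'e) chart"

definition smooth_manifold ::
  "('m::{t2_space, second_countable_topology}, 'e::euclidean_space) manifold \<Rightarrow> bool" where
  "smooth_manifold M \<longleftrightarrow>
     (\<forall>c\<in>atlas M. open (chart_dom c) \<and> open (chart_image c) \<and>
        homeomorphism (chart_dom c) (chart_image c) (chart_map c) (chart_inv c)) \<and>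
     (\<forall>c\<in>atlas M. \<forall>d\<in>atlas M.
        smooth_on (transition c d) (chart_map c ` (chart_dom c \<inter> chart_dom d))) \<and>
     (\<forall>p. chart_at M p \<in> atlas M \<and> p \<in> chart_dom (chart_at M p))"

definition smooth_functions :: "('m, 'e::euclidean_space) manifold \<Rightarrow> ('m \<Rightarrow> real) set" where
  "smooth_functions M = {f. \<forall>c\<in>atlas M. smooth_on (f \<circ> chart_inv c) (chart_image c)}"

text \<open>The components in the chart \<open>c\<close> of a tangent vector \<open>v\<close> at \<open>p\<close>.\<close>

definition components_in ::
  "('m, 'e::euclidean_space) manifold \<Rightarrow> ('m, 'e) chart \<Rightarrow> 'm \<Rightarrow> 'e \<Rightarrow> 'e" where
  "components_in M c p v =
     frechet_derivative (transition (chart_at M p) c) (at (chart_map (chart_at M p) p)) v"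

definition local_rep ::
  "('m, 'e::euclidean_space) manifold \<Rightarrow> ('m, 'e) chart \<Rightarrow> ('m \<Rightarrow> 'e) \<Rightarrow> 'e \<Rightarrow> 'e" where
  "local_rep M c X = (\<lambda>x. components_in M c (chart_inv c x) (X (chart_inv c x)))"

definition vector_fields :: "('m, 'e::euclidean_space) manifold \<Rightarrow> ('m \<Rightarrow> 'e) set" where
  "vector_fields M = {X. \<forall>c\<in>atlas M. smooth_on (local_rep M c X) (chart_image c)}"

text \<open>The function \<open>X f\<close>.\<close>

definition deriv_along ::
  "('m, 'e::euclidean_space) manifold \<Rightarrow> ('m \<Rightarrow> 'e) \<Rightarrow> ('m \<Rightarrow> real) \<Rightarrow> 'm \<Rightarrow> real" where
  "deriv_along M X f p =
     frechet_derivative (f \<circ> chart_inv (chart_at M p)) (at (chart_map (chart_at M p) p)) (X p)"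

text \<open>\<open>[X,Y] = DY(X) - DX(Y)\<close> in the components of the preferred chart at \<open>p\<close>.\<close>

definition lie_bracket ::
  "('m, 'e::euclidean_space) manifold \<Rightarrow> ('m \<Rightarrow> 'e) \<Rightarrow> ('m \<Rightarrow> 'e) \<Rightarrow> 'm \<Rightarrow> 'e" where
  "lie_bracket M X Y p = (let c = chart_at M p; x = chart_map c p in
     frechet_derivative (local_rep M c Y) (at x) (X p) -
     frechet_derivative (local_rep M c X) (at x) (Y p))"

section \<open>Tensor fields\<close>

text \<open>
  Tensor fields are families of multilinear maps on the tangent spaces; \<open>app1\<close> and
  \<open>app2\<close> apply them pointwise to vector fields.
\<close>

definition app1 :: "('m \<Rightarrow> 'e \<Rightarrow> 'b) \<Rightarrow> ('m \<Rightarrow> 'e) \<Rightarrow> 'm \<Rightarrow> 'b" where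
  "app1 T X = (\<lambda>p. T p (X p))"

definition app2 :: "('m \<Rightarrow> 'e \<Rightarrow> 'e \<Rightarrow> 'b) \<Rightarrow> ('m \<Rightarrow> 'e) \<Rightarrow> ('m \<Rightarrow> 'e) \<Rightarrow> 'm \<Rightarrow> 'b" where
  "app2 T X Y = (\<lambda>p. T p (X p) (Y p))"

definition endomorphism_field ::
  "('m, 'e::euclidean_space) manifold \<Rightarrow> ('m \<Rightarrow> 'e \<Rightarrow> 'e) \<Rightarrow> bool" where
  "endomorphism_field M A \<longleftrightarrow>
     (\<forall>p. linear (A p)) \<and> (\<forall>X\<in>vector_fields M. app1 A X \<in> vector_fields M)"

definition tensor_field_1_2 ::
  "('m, 'e::euclidean_space) manifold \<Rightarrow> ('m \<Rightarrow> 'e \<Rightarrow> 'e \<Rightarrow> 'e) \<Rightarrow> bool" where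
  "tensor_field_1_2 M K \<longleftrightarrow>
     (\<forall>p. bilinear (K p)) \<and>
     (\<forall>X\<in>vector_fields M. \<forall>Y\<in>vector_fields M. app2 K X Y \<in> vector_fields M)"

definition riemannian_manifold ::
  "('m::{t2_space, second_countable_topology}, 'e::euclidean_space) manifold \<Rightarrow>
    ('m \<Rightarrow> 'e \<Rightarrow> 'e \<Rightarrow> real) \<Rightarrow> bool" where
  "riemannian_manifold M g \<longleftrightarrow>
     smooth_manifold M \<and>
     (\<forall>p. bilinear (g p)) \<and>
     (\<forall>p u v. g p u v = g p v u) \<and>
     (\<forall>p u. u \<noteq> 0 \<longrightarrow> g p u u > 0) \<and>
     (\<forall>X\<in>vector_fields M. \<forall>Y\<in>vector_fields M. app2 g X Y \<in> smooth_functions M)"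

section \<open>Connections and curvature\<close>

text \<open>An affine connection; \<open>D X Y\<close> is only meaningful for smooth vector fields \<open>X\<close>, \<open>Y\<close>.\<close>

definition affine_connection ::
  "('m, 'e::euclidean_space) manifold \<Rightarrow> (('m \<Rightarrow> 'e) \<Rightarrow> ('m \<Rightarrow> 'e) \<Rightarrow> 'm \<Rightarrow> 'e) \<Rightarrow> bool" where
  "affine_connection M D \<longleftrightarrow>
     (\<forall>X\<in>vector_fields M. \<forall>Y\<in>vector_fields M. D X Y \<in> vector_fields M) \<and>
     (\<forall>X\<in>vector_fields M. \<forall>Y\<in>vector_fields M. \<forall>Z\<in>vector_fields M. \<forall>p.
        D (\<lambda>q. X q + Y q) Z p = D X Z p + D Y Z p \<and>
        D X (\<lambda>q. Y q + Z q) p = D X Y p + D X Z p) \<and>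
     (\<forall>f\<in>smooth_functions M. \<forall>X\<in>vector_fields M. \<forall>Y\<in>vector_fields M. \<forall>p.
        D (\<lambda>q. f q *\<^sub>R X q) Y p = f p *\<^sub>R D X Y p \<and>
        D X (\<lambda>q. f q *\<^sub>R Y q) p = f p *\<^sub>R D X Y p + deriv_along M X f p *\<^sub>R Y p)"

definition torsion_free ::
  "('m, 'e::euclidean_space) manifold \<Rightarrow> (('m \<Rightarrow> 'e) \<Rightarrow> ('m \<Rightarrow> 'e) \<Rightarrow> 'm \<Rightarrow> 'e) \<Rightarrow> bool" where
  "torsion_free M D \<longleftrightarrow>
     (\<forall>X\<in>vector_fields M. \<forall>Y\<in>vector_fields M. \<forall>p. D X Y p - D Y X p = lie_bracket M X Y p)"

text \<open>\<open>(\<nabla>\<^sub>X g)(Y, Z)\<close>\<close>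

definition deriv_metric ::
  "('m, 'e::euclidean_space) manifold \<Rightarrow> (('m \<Rightarrow> 'e) \<Rightarrow> ('m \<Rightarrow> 'e) \<Rightarrow> 'm \<Rightarrow> 'e) \<Rightarrow>
    ('m \<Rightarrow> 'e \<Rightarrow> 'e \<Rightarrow> real) \<Rightarrow> ('m \<Rightarrow> 'e) \<Rightarrow> ('m \<Rightarrow> 'e) \<Rightarrow> ('m \<Rightarrow> 'e) \<Rightarrow> 'm \<Rightarrow> real" where
  "deriv_metric M D g X Y Z p =
     deriv_along M X (app2 g Y Z) p - g p (D X Y p) (Z p) - g p (Y p) (D X Z p)"

definition levi_civita ::
  "('m::{t2_space, second_countable_topology}, 'e::euclidean_space) manifold \<Rightarrow>
    ('m \<Rightarrow> 'e \<Rightarrow> 'e \<Rightarrow> real) \<Rightarrow> (('m \<Rightarrow> 'e) \<Rightarrow> ('m \<Rightarrow> 'e) \<Rightarrow> 'm \<Rightarrow> 'e) \<Rightarrow> bool" where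
  "levi_civita M g D \<longleftrightarrow>
     riemannian_manifold M g \<and> affine_connection M D \<and> torsion_free M D \<and>
     (\<forall>X\<in>vector_fields M. \<forall>Y\<in>vector_fields M. \<forall>Z\<in>vector_fields M. \<forall>p.
        deriv_metric M D g X Y Z p = 0)"

text \<open>\<open>D\<close> differentiates \<open>Y\<close> along \<open>X\<close>, so \<open>(\<nabla>\<^sub>X A) Y = \<nabla>\<^sub>X (A Y) - A (\<nabla>\<^sub>X Y)\<close>.\<close>

definition deriv_endo ::
  "(('m \<Rightarrow> 'e::real_vector) \<Rightarrow> ('m \<Rightarrow> 'e) \<Rightarrow> 'm \<Rightarrow> 'e) \<Rightarrow> ('m \<Rightarrow> 'e \<Rightarrow> 'e) \<Rightarrow>
    ('m \<Rightarrow> 'e) \<Rightarrow> ('m \<Rightarrow> 'e) \<Rightarrow> 'm \<Rightarrow> 'e" where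
  "deriv_endo D A X Y p = D X (app1 A Y) p - A p (D X Y p)"

definition curvature ::
  "('m, 'e::euclidean_space) manifold \<Rightarrow> (('m \<Rightarrow> 'e) \<Rightarrow> ('m \<Rightarrow> 'e) \<Rightarrow> 'm \<Rightarrow> 'e) \<Rightarrow>
    ('m \<Rightarrow> 'e) \<Rightarrow> ('m \<Rightarrow> 'e) \<Rightarrow> ('m \<Rightarrow> 'e) \<Rightarrow> 'm \<Rightarrow> 'e" where
  "curvature M D X Y Z p = D X (D Y Z) p - D Y (D X Z) p - D (lie_bracket M X Y) Z p"

section \<open>Statistical manifolds\<close>

definition statistical_manifold ::
  "('m::{t2_space, second_countable_topology}, 'e::euclidean_space) manifold \<Rightarrow>
    (('m \<Rightarrow> 'e) \<Rightarrow> ('m \<Rightarrow> 'e) \<Rightarrow> 'm \<Rightarrow> 'e) \<Rightarrow> ('m \<Rightarrow> 'e \<Rightarrow> 'e \<Rightarrow> real) \<Rightarrow> bool" where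
  "statistical_manifold M N g \<longleftrightarrow>
     riemannian_manifold M g \<and> affine_connection M N \<and> torsion_free M N \<and>
     (\<forall>X\<in>vector_fields M. \<forall>Y\<in>vector_fields M. \<forall>Z\<in>vector_fields M. \<forall>p.
        deriv_metric M N g X Y Z p = deriv_metric M N g Y X Z p \<and>
        deriv_metric M N g X Y Z p = deriv_metric M N g X Z Y p)"

definition add_tensor ::
  "(('m \<Rightarrow> 'e::real_vector) \<Rightarrow> ('m \<Rightarrow> 'e) \<Rightarrow> 'm \<Rightarrow> 'e) \<Rightarrow> ('m \<Rightarrow> 'e \<Rightarrow> 'e \<Rightarrow> 'e) \<Rightarrow>
    ('m \<Rightarrow> 'e) \<Rightarrow> ('m \<Rightarrow> 'e) \<Rightarrow> 'm \<Rightarrow> 'e" where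
  "add_tensor D K X Y p = D X Y p + K p (X p) (Y p)"

text \<open>
  A statistical structure \<open>(\<nabla>\<^sup>g + K, g)\<close>, presented by the Levi-Civita connection
  \<open>D = \<nabla>\<^sup>g\<close> and the difference tensor \<open>K\<close>.
\<close>

definition statistical_structure ::
  "('m::{t2_space, second_countable_topology}, 'e::euclidean_space) manifold \<Rightarrow>
    ('m \<Rightarrow> 'e \<Rightarrow> 'e \<Rightarrow> real) \<Rightarrow> (('m \<Rightarrow> 'e) \<Rightarrow> ('m \<Rightarrow> 'e) \<Rightarrow> 'm \<Rightarrow> 'e) \<Rightarrow>
    ('m \<Rightarrow> 'e \<Rightarrow> 'e \<Rightarrow> 'e) \<Rightarrow> bool" where
  "statistical_structure M g D K \<longleftrightarrow>
     levi_civita M g D \<and> tensor_field_1_2 M K \<and> statistical_manifold M (add_tensor D K) g"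

text \<open>\<open>S(X,Y)Z = R\<^sup>g(X,Y)Z + [K\<^sub>X, K\<^sub>Y] Z\<close>\<close>

definition statistical_curvature ::
  "('m, 'e::euclidean_space) manifold \<Rightarrow> (('m \<Rightarrow> 'e) \<Rightarrow> ('m \<Rightarrow> 'e) \<Rightarrow> 'm \<Rightarrow> 'e) \<Rightarrow>
    ('m \<Rightarrow> 'e \<Rightarrow> 'e \<Rightarrow> 'e) \<Rightarrow> ('m \<Rightarrow> 'e) \<Rightarrow> ('m \<Rightarrow> 'e) \<Rightarrow> ('m \<Rightarrow> 'e) \<Rightarrow> 'm \<Rightarrow> 'e" where
  "statistical_curvature M D K X Y Z p =
     curvature M D X Y Z p + (K p (X p) (K p (Y p) (Z p)) - K p (Y p) (K p (X p) (Z p)))"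

text \<open>
  The trace of an endomorphism of the model space, computed in its standard basis; it does
  not depend on the inner product of \<open>'e\<close>.
\<close>

definition endo_trace :: "('e::euclidean_space \<Rightarrow> 'e) \<Rightarrow> real" where
  "endo_trace L = (\<Sum>b\<in>Basis. L b \<bullet> b)"

text \<open>
  A function-linear operator \<open>F\<close> on vector fields induces an endomorphism of each tangent
  space: apply \<open>F\<close> to any smooth vector field with the prescribed value at \<open>p\<close>.
\<close>

definition endo_at ::
  "('m, 'e::euclidean_space) manifold \<Rightarrow> (('m \<Rightarrow> 'e) \<Rightarrow> 'm \<Rightarrow> 'e) \<Rightarrow> 'm \<Rightarrow> 'e \<Rightarrow> 'e" where
  "endo_at M F p v = F (SOME X. X \<in> vector_fields M \<and> X p = v) p"

definition ricci ::
  "('m, 'e::euclidean_space) manifold \<Rightarrow> (('m \<Rightarrow> 'e) \<Rightarrow> ('m \<Rightarrow> 'e) \<Rightarrow> 'm \<Rightarrow> 'e) \<Rightarrow>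
    ('m \<Rightarrow> 'e \<Rightarrow> 'e \<Rightarrow> 'e) \<Rightarrow> ('m \<Rightarrow> 'e) \<Rightarrow> ('m \<Rightarrow> 'e) \<Rightarrow> 'm \<Rightarrow> real" where
  "ricci M D K Y Z p = endo_trace (endo_at M (\<lambda>X. statistical_curvature M D K X Y Z) p)"

definition ricci_flat ::
  "('m, 'e::euclidean_space) manifold \<Rightarrow> (('m \<Rightarrow> 'e) \<Rightarrow> ('m \<Rightarrow> 'e) \<Rightarrow> 'm \<Rightarrow> 'e) \<Rightarrow>
    ('m \<Rightarrow> 'e \<Rightarrow> 'e \<Rightarrow> 'e) \<Rightarrow> bool" where
  "ricci_flat M D K \<longleftrightarrow>
     (\<forall>X\<in>vector_fields M. \<forall>Y\<in>vector_fields M. \<forall>p. ricci M D K X Y p = 0)"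

section \<open>Holomorphic and Kenmotsu statistical manifolds\<close>

definition kaehler_manifold ::
  "('m::{t2_space, second_countable_topology}, 'e::euclidean_space) manifold \<Rightarrow>
    ('m \<Rightarrow> 'e \<Rightarrow> 'e \<Rightarrow> real) \<Rightarrow> ('m \<Rightarrow> 'e \<Rightarrow> 'e) \<Rightarrow>
    (('m \<Rightarrow> 'e) \<Rightarrow> ('m \<Rightarrow> 'e) \<Rightarrow> 'm \<Rightarrow> 'e) \<Rightarrow> bool" where
  "kaehler_manifold M g J D \<longleftrightarrow>
     levi_civita M g D \<and> endomorphism_field M J \<and>
     (\<forall>p u. J p (J p u) = - u) \<and>
     (\<forall>p u v. g p (J p u) (J p v) = g p u v) \<and>
     (\<forall>X\<in>vector_fields M. \<forall>Y\<in>vector_fields M. \<forall>p. deriv_endo D J X Y p = 0)"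

definition holomorphic_statistical_manifold ::
  "('m::{t2_space, second_countable_topology}, 'e::euclidean_space) manifold \<Rightarrow>
    (('m \<Rightarrow> 'e) \<Rightarrow> ('m \<Rightarrow> 'e) \<Rightarrow> 'm \<Rightarrow> 'e) \<Rightarrow> ('m \<Rightarrow> 'e \<Rightarrow> 'e \<Rightarrow> 'e) \<Rightarrow>
    ('m \<Rightarrow> 'e \<Rightarrow> 'e \<Rightarrow> real) \<Rightarrow> ('m \<Rightarrow> 'e \<Rightarrow> 'e) \<Rightarrow> bool" where
  "holomorphic_statistical_manifold M D K g J \<longleftrightarrow>
     kaehler_manifold M g J D \<and> statistical_structure M g D K \<and>
     (\<forall>p u v. K p u (J p v) = - J p (K p u v))"

text \<open>The contact form is \<open>\<eta>(u) = g(u, \<xi>)\<close>.\<close>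

definition almost_contact_metric_manifold ::
  "('m::{t2_space, second_countable_topology}, 'e::euclidean_space) manifold \<Rightarrow>
    ('m \<Rightarrow> 'e \<Rightarrow> 'e \<Rightarrow> real) \<Rightarrow> ('m \<Rightarrow> 'e \<Rightarrow> 'e) \<Rightarrow> ('m \<Rightarrow> 'e) \<Rightarrow> bool" where
  "almost_contact_metric_manifold M g \<phi> \<xi> \<longleftrightarrow>
     riemannian_manifold M g \<and> endomorphism_field M \<phi> \<and> \<xi> \<in> vector_fields M \<and>
     (\<forall>p. g p (\<xi> p) (\<xi> p) = 1) \<and>
     (\<forall>p u. \<phi> p (\<phi> p u) = - u + g p u (\<xi> p) *\<^sub>R \<xi> p) \<and>
     (\<forall>p u v. g p (\<phi> p u) (\<phi> p v) = g p u v - g p u (\<xi> p) * g p v (\<xi> p))"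

definition kenmotsu_manifold ::
  "('m::{t2_space, second_countable_topology}, 'e::euclidean_space) manifold \<Rightarrow>
    ('m \<Rightarrow> 'e \<Rightarrow> 'e \<Rightarrow> real) \<Rightarrow> ('m \<Rightarrow> 'e \<Rightarrow> 'e) \<Rightarrow> ('m \<Rightarrow> 'e) \<Rightarrow>
    (('m \<Rightarrow> 'e) \<Rightarrow> ('m \<Rightarrow> 'e) \<Rightarrow> 'm \<Rightarrow> 'e) \<Rightarrow> bool" where
  "kenmotsu_manifold M g \<phi> \<xi> D \<longleftrightarrow>
     almost_contact_metric_manifold M g \<phi> \<xi> \<and> levi_civita M g D \<and>
     (\<forall>X\<in>vector_fields M. \<forall>Y\<in>vector_fields M. \<forall>p.
        deriv_endo D \<phi> X Y p =
          g p (\<phi> p (X p)) (Y p) *\<^sub>R \<xi> p - g p (Y p) (\<xi> p) *\<^sub>R \<phi> p (X p)) \<and>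
     (\<forall>X\<in>vector_fields M. \<forall>p. D X \<xi> p = X p - g p (X p) (\<xi> p) *\<^sub>R \<xi> p)"

definition kenmotsu_statistical_manifold ::
  "('m::{t2_space, second_countable_topology}, 'e::euclidean_space) manifold \<Rightarrow>
    (('m \<Rightarrow> 'e) \<Rightarrow> ('m \<Rightarrow> 'e) \<Rightarrow> 'm \<Rightarrow> 'e) \<Rightarrow> ('m \<Rightarrow> 'e \<Rightarrow> 'e \<Rightarrow> 'e) \<Rightarrow>
    ('m \<Rightarrow> 'e \<Rightarrow> 'e \<Rightarrow> real) \<Rightarrow> ('m \<Rightarrow> 'e \<Rightarrow> 'e) \<Rightarrow> ('m \<Rightarrow> 'e) \<Rightarrow> bool" where
  "kenmotsu_statistical_manifold M D K g \<phi> \<xi> \<longleftrightarrow>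
     kenmotsu_manifold M g \<phi> \<xi> D \<and> statistical_structure M g D K \<and>
     (\<forall>p u v. K p u (\<phi> p v) = - \<phi> p (K p u v))"

definition constant_phi_sectional_curvature ::
  "('m, 'e::euclidean_space) manifold \<Rightarrow>
    (('m \<Rightarrow> 'e) \<Rightarrow> ('m \<Rightarrow> 'e) \<Rightarrow> 'm \<Rightarrow> 'e) \<Rightarrow> ('m \<Rightarrow> 'e \<Rightarrow> 'e \<Rightarrow> 'e) \<Rightarrow>
    ('m \<Rightarrow> 'e \<Rightarrow> 'e \<Rightarrow> real) \<Rightarrow> ('m \<Rightarrow> 'e \<Rightarrow> 'e) \<Rightarrow> ('m \<Rightarrow> 'e) \<Rightarrow> real \<Rightarrow> bool" where
  "constant_phi_sectional_curvature M D K g \<phi> \<xi> c \<longleftrightarrow>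
     (\<forall>X\<in>vector_fields M. \<forall>Y\<in>vector_fields M. \<forall>Z\<in>vector_fields M. \<forall>p.
        statistical_curvature M D K X Y Z p =
          ((c - 3) / 4) *\<^sub>R (g p (Y p) (Z p) *\<^sub>R X p - g p (X p) (Z p) *\<^sub>R Y p) +
          ((c + 1) / 4) *\<^sub>R
            (g p (\<phi> p (Y p)) (Z p) *\<^sub>R \<phi> p (X p)
             - g p (\<phi> p (X p)) (Z p) *\<^sub>R \<phi> p (Y p)
             - (2 * g p (\<phi> p (X p)) (Y p)) *\<^sub>R \<phi> p (Z p)
             - (g p (Y p) (\<xi> p) * g p (Z p) (\<xi> p)) *\<^sub>R X p
             + (g p (X p) (\<xi> p) * g p (Z p) (\<xi> p)) *\<^sub>R Y p
             + (g p (Y p) (\<xi> p) * g p (Z p) (X p)) *\<^sub>R \<xi> p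
             - (g p (X p) (\<xi> p) * g p (Z p) (Y p)) *\<^sub>R \<xi> p))"

section \<open>The warped product with the real line\<close>

text \<open>
  The preferred charts of \<open>M \<times> \<real>\<close> are products as well, so the tangent space at \<open>(p, a)\<close>
  is the product of the tangent space of \<open>M\<close> at \<open>p\<close> with \<open>\<real>\<close>; the second component is the
  coefficient of \<open>\<partial>/\<partial>a\<close>.
\<close>

definition line_chart :: "('m, 'e) chart \<Rightarrow> ('m \<times> real, 'e \<times> real) chart" where
  "line_chart c = (chart_dom c \<times> UNIV, \<lambda>(p, a). (chart_map c p, a))"

definition times_line :: "('m, 'e) manifold \<Rightarrow> ('m \<times> real, 'e \<times> real) manifold" where
  "times_line M = \<lparr>atlas = line_chart ` atlas M, chart_at = (\<lambda>(p, a). line_chart (chart_at M p))\<rparr>"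

definition warped_metric ::
  "('m \<Rightarrow> 'e \<Rightarrow> 'e \<Rightarrow> real) \<Rightarrow> 'm \<times> real \<Rightarrow> 'e \<times> real \<Rightarrow> 'e \<times> real \<Rightarrow> real" where
  "warped_metric g = (\<lambda>(p, a) (u, r) (v, t). exp (2 * a) * g p u v + r * t)"

definition line_field :: "'m \<times> real \<Rightarrow> 'e::zero \<times> real" where
  "line_field = (\<lambda>_. (0, 1))"

definition extend_endo :: "('m \<Rightarrow> 'e \<Rightarrow> 'e) \<Rightarrow> 'm \<times> real \<Rightarrow> 'e \<times> real \<Rightarrow> 'e \<times> real" where
  "extend_endo J = (\<lambda>(p, a) (u, r). (J p u, 0))"

end

theory Submission
  imports Defs
begin

text \<open>
  The curvature formula is pointwise in all arguments, so the Ricci tensor is the trace of an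
  explicit endomorphism: rank-one pieces have trace \<open>f w\<close>, and \<open>\<phi>\<close> is skew for a positive
  definite form, hence traceless. What needs work is that \<open>endo_at\<close> only makes sense if every
  tangent vector extends to a global smooth vector field. The extension is a constant field in a
  chart, cut off by a bump function built from \<open>exp (-1/t)\<close>; the Hausdorff property makes its
  compact support closed, so that extension by zero is smooth.
\<close>

section \<open>Calculus of \<open>C\<^sup>k\<close> maps\<close>

text \<open>The congruence rule is a hypothesis because its own inductive proof goes through this lemma.\<close>

lemma Ck_on_SucI:
  fixes f :: "'a::real_normed_vector \<Rightarrow> 'b::real_normed_vector"
  assumes S: "open S" and f: "\<And>x. x \<in> S \<Longrightarrow> (f has_derivative f' x) (at x)"
    and f': "\<And>v. Ck_on k (\<lambda>x. f' x v) S"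
    and cong: "\<And>g h :: 'a \<Rightarrow> 'b. (\<And>x. x \<in> S \<Longrightarrow> g x = h x) \<Longrightarrow> Ck_on k g S \<Longrightarrow> Ck_on k h S"
  shows "Ck_on (Suc k) f S"
proof -
  have "f' x v = frechet_derivative f (at x) v" if "x \<in> S" for x v
    using frechet_derivative_at[OF f[OF that]] by simp
  then have "Ck_on k (\<lambda>x. frechet_derivative f (at x) v) S" for v
    by (rule cong[OF _ f'])
  moreover have "f differentiable_on S"
    unfolding differentiable_on_def differentiable_def
    using f has_derivative_at_withinI by blast
  ultimately show ?thesis by simp
qed

text \<open>The derivative at a point of an open set depends only on nearby values, so the
  derivative of \<open>f\<close> serves for \<open>g\<close> as well, and its directional
  derivatives are C^k by assumption. The induction hypothesis is the congruence premise of
  \<open>Ck_on_SucI\<close>.\<close>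

lemma Ck_on_cong:
  assumes "open S" and "\<And>x. x \<in> S \<Longrightarrow> f x = g x" and "Ck_on k f S"
  shows "Ck_on k g S"
  using assms(2,3)
proof (induction k arbitrary: f g)
  case 0
  then show ?case by (simp cong: continuous_on_cong)
next
  case (Suc k)
  have "(g has_derivative frechet_derivative f (at x)) (at x)" if "x \<in> S" for x
  proof -
    have "(f has_derivative frechet_derivative f (at x)) (at x)"
      using Suc.prems(2) that assms(1)
      by (simp add: differentiable_on_eq_differentiable_at frechet_derivative_works)
    then show ?thesis
      by (rule has_derivative_transform_within_open[OF _ assms(1) that]) (rule Suc.prems(1))
  qed
  then show ?case
  proof (rule Ck_on_SucI[OF assms(1)])
    show "Ck_on k (\<lambda>x. frechet_derivative f (at x) v) S" for v
      using Suc.prems(2) by simp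
    show "Ck_on k h' S" if "\<And>x. x \<in> S \<Longrightarrow> g' x = h' x" "Ck_on k g' S" for g' h' :: "'a \<Rightarrow> 'b"
      using that by (rule Suc.IH)
  qed
qed

text \<open>\<open>Ck_on_SucI\<close> with congruence discharged: an explicit derivative formula
  valid on \<open>S\<close> may stand in for \<open>frechet_derivative\<close> in the inductions
  that follow.\<close>

lemma Ck_on_Suc_has_derivativeI:
  assumes "open S" and "\<And>x. x \<in> S \<Longrightarrow> (f has_derivative f' x) (at x)"
    and "\<And>v. Ck_on k (\<lambda>x. f' x v) S"
  shows "Ck_on (Suc k) f S"
  by (rule Ck_on_SucI[OF assms]) (assumption | rule Ck_on_cong[OF assms(1)])+

lemma Ck_on_Suc_has_derivative:
  assumes "open S" and "Ck_on (Suc k) f S" and "x \<in> S"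
  shows "(f has_derivative frechet_derivative f (at x)) (at x)"
  using assms by (simp add: differentiable_on_eq_differentiable_at frechet_derivative_works)

lemma Ck_on_SucD: "Ck_on (Suc k) f S \<Longrightarrow> Ck_on k f S"
proof (induction k arbitrary: f)
  case 0
  then show ?case by (simp add: differentiable_imp_continuous_on)
next
  case (Suc k)
  from Suc.prems have "f differentiable_on S"
    and "\<And>v. Ck_on (Suc k) (\<lambda>x. frechet_derivative f (at x) v) S"
    by auto
  then show ?case using Suc.IH by auto
qed

text \<open>Continuity and differentiability are local on open sets. This glues the coordinate form
  of a cut-off field from two open pieces.\<close>

lemma Ck_on_Un:
  assumes "open S" "open T" "Ck_on k f S" "Ck_on k f T"
  shows "Ck_on k f (S \<union> T)"
  using assms(3,4)
  by (induction k arbitrary: f)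
    (auto intro: continuous_on_open_Un
      simp: assms open_Un differentiable_on_eq_differentiable_at)

lemma Ck_on_const [simp]: "Ck_on k (\<lambda>x. a) S"
  by (induction k arbitrary: a) (auto simp: frechet_derivative_const)

lemma Ck_on_id: "open S \<Longrightarrow> Ck_on k (\<lambda>x. x) S"
proof (cases k)
  case (Suc m)
  assume "open S"
  then show ?thesis
    unfolding Suc by (intro Ck_on_Suc_has_derivativeI[where f' = "\<lambda>x v. v"]) auto
qed simp

lemma Ck_on_add:
  assumes S: "open S"
  shows "Ck_on k f S \<Longrightarrow> Ck_on k g S \<Longrightarrow> Ck_on k (\<lambda>x. f x + g x) S"
proof (induction k arbitrary: f g)
  case (Suc k)
  show ?case
  proof (rule Ck_on_Suc_has_derivativeI[OF S])
    show "((\<lambda>x. f x + g x) has_derivative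
        (\<lambda>v. frechet_derivative f (at x) v + frechet_derivative g (at x) v)) (at x)"
      if "x \<in> S" for x
      using Ck_on_Suc_has_derivative[OF S] Suc.prems that by (intro has_derivative_add) blast+
    show "Ck_on k (\<lambda>x. frechet_derivative f (at x) v + frechet_derivative g (at x) v) S" for v
      using Suc.prems by (intro Suc.IH) simp_all
  qed
qed (simp add: continuous_on_add)

lemma Ck_on_sum:
  assumes "open S" and "\<And>i. i \<in> I \<Longrightarrow> Ck_on k (f i) S"
  shows "Ck_on k (\<lambda>x. \<Sum>i\<in>I. f i x) S"
  using assms(2) by (induction I rule: infinite_finite_induct) (auto intro: Ck_on_add[OF assms(1)])

text \<open>The Leibniz rule gives two terms of the same shape, so the induction closes. One proof
  serves both scaling and inner products.\<close>

lemma Ck_on_bounded_bilinear: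
  assumes b: "bounded_bilinear b" and S: "open S"
  shows "Ck_on k f S \<Longrightarrow> Ck_on k g S \<Longrightarrow> Ck_on k (\<lambda>x. b (f x) (g x)) S"
proof (induction k arbitrary: f g)
  case 0
  then show ?case by (auto intro: bounded_bilinear.continuous_on[OF b])
next
  case (Suc k)
  show ?case
  proof (rule Ck_on_Suc_has_derivativeI[OF S])
    show "((\<lambda>x. b (f x) (g x)) has_derivative
        (\<lambda>v. b (f x) (frechet_derivative g (at x) v) + b (frechet_derivative f (at x) v) (g x))) (at x)"
      if "x \<in> S" for x
      using Ck_on_Suc_has_derivative[OF S Suc.prems(1) that]
        Ck_on_Suc_has_derivative[OF S Suc.prems(2) that]
      by (rule bounded_bilinear.FDERIV[OF b])
    show "Ck_on k (\<lambda>x. b (f x) (frechet_derivative g (at x) v) + b (frechet_derivative f (at x) v) (g x)) S"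
      for v
      using Suc.prems Ck_on_SucD[OF Suc.prems(1)] Ck_on_SucD[OF Suc.prems(2)]
      by (intro Ck_on_add[OF S] Suc.IH) auto
  qed
qed

lemmas Ck_on_scaleR = Ck_on_bounded_bilinear[OF bounded_bilinear_scaleR]
lemmas Ck_on_inner = Ck_on_bounded_bilinear[OF bounded_bilinear_inner]

text \<open>In the chain rule the direction fed to the derivative of \<open>f\<close> varies with
  \<open>x\<close>, while the induction hypothesis speaks of fixed directions. Expanding that
  direction in \<open>Basis\<close> gives a finite sum of components of the derivative of
  \<open>g\<close> times derivatives of \<open>f\<close> in fixed directions
  \<open>b\<close>.\<close>

lemma Ck_on_compose:
  fixes f :: "'b::euclidean_space \<Rightarrow> 'c::real_normed_vector"
  assumes S: "open S" and T: "open T" and gST: "g ` S \<subseteq> T"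
  shows "Ck_on k f T \<Longrightarrow> Ck_on k g S \<Longrightarrow> Ck_on k (\<lambda>x. f (g x)) S"
proof (induction k arbitrary: f)
  case 0
  then show ?case using continuous_on_compose2[OF _ _ gST] by simp
next
  case (Suc k)
  let ?Df = "\<lambda>y. frechet_derivative f (at y)" and ?Dg = "\<lambda>x. frechet_derivative g (at x)"
  have Df: "(f has_derivative ?Df (g x)) (at (g x))" if "x \<in> S" for x
    using that gST by (intro Ck_on_Suc_has_derivative[OF T Suc.prems(1)]) auto
  show ?case
  proof (rule Ck_on_Suc_has_derivativeI[OF S])
    show "((\<lambda>x. f (g x)) has_derivative (\<lambda>v. \<Sum>b\<in>Basis. (?Dg x v \<bullet> b) *\<^sub>R ?Df (g x) b)) (at x)"
      if "x \<in> S" for x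
    proof -
      have "((\<lambda>x. f (g x)) has_derivative (\<lambda>v. ?Df (g x) (?Dg x v))) (at x)"
        using Ck_on_Suc_has_derivative[OF S Suc.prems(2) that] Df[OF that]
        by (rule has_derivative_compose)
      moreover have "?Df (g x) w = (\<Sum>b\<in>Basis. (w \<bullet> b) *\<^sub>R ?Df (g x) b)" for w
      proof -
        have "?Df (g x) w = ?Df (g x) (\<Sum>b\<in>Basis. (w \<bullet> b) *\<^sub>R b)"
          by (simp only: euclidean_representation)
        also have "\<dots> = (\<Sum>b\<in>Basis. (w \<bullet> b) *\<^sub>R ?Df (g x) b)"
          by (simp only: linear_sum[OF has_derivative_linear[OF Df[OF that]]]
              linear_scale[OF has_derivative_linear[OF Df[OF that]]])
        finally show ?thesis .
      qed
      ultimately show ?thesis by (rule has_derivative_eq_rhs[OF _ ext])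
    qed
    have Df_g: "Ck_on k (\<lambda>x. ?Df (g x) b) S" for b
      by (rule Suc.IH) (use Suc.prems(1) Ck_on_SucD[OF Suc.prems(2)] in simp_all)
    have Dg: "Ck_on k (\<lambda>x. ?Dg x v \<bullet> b) S" for v b
      by (rule Ck_on_inner[OF S _ Ck_on_const]) (use Suc.prems(2) in simp)
    show "Ck_on k (\<lambda>x. \<Sum>b\<in>Basis. (?Dg x v \<bullet> b) *\<^sub>R ?Df (g x) b) S" for v
      by (rule Ck_on_sum[OF S], rule Ck_on_scaleR[OF S Dg Df_g])
  qed
qed

section \<open>Bump functions\<close>

text \<open>The case \<open>n = 0\<close> is the classical flat function. The extra powers of
  \<open>inverse t\<close> make the span of the family closed under differentiation.\<close>

definition flat_fun :: "nat \<Rightarrow> real \<Rightarrow> real" where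
  "flat_fun n t = (if t > 0 then inverse t ^ n * exp (- inverse t) else 0)"

text \<open>The exponential series at \<open>inverse t\<close> dominates its single term of index
  \<open>n + 2\<close>. The two surplus powers leave \<open>t\<^sup>2\<close>, enough to kill the
  difference quotient at 0.\<close>

lemma flat_fun_le: "\<bar>flat_fun n t\<bar> \<le> fact (n + 2) * t\<^sup>2"
proof (cases "t > 0")
  case True
  let ?y = "inverse t"
  have "sum (\<lambda>k. ?y ^ k /\<^sub>R fact k) {n + 2} \<le> exp ?y"
    unfolding exp_def using True
    by (intro sum_le_suminf summable_exp_generic) auto
  then have "fact (n + 2) * (?y ^ (n + 2) /\<^sub>R fact (n + 2)) \<le> fact (n + 2) * exp ?y"
    by (intro mult_left_mono) (simp_all del: fact_Suc power_Suc)
  then have le: "?y ^ (n + 2) \<le> fact (n + 2) * exp ?y"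
    by (simp del: fact_Suc power_Suc add: mult.assoc[symmetric])
  have "?y ^ n * exp (- ?y) = ?y ^ (n + 2) * (t\<^sup>2 * exp (- ?y))"
    using True by (simp add: power_add power2_eq_square field_simps)
  also have "\<dots> \<le> (fact (n + 2) * exp ?y) * (t\<^sup>2 * exp (- ?y))"
    using le by (rule mult_right_mono) simp
  also have "\<dots> = fact (n + 2) * t\<^sup>2"
    by (simp add: exp_minus del: fact_Suc)
  finally show ?thesis
    using True by (simp add: flat_fun_def abs_mult del: fact_Suc)
qed (simp add: flat_fun_def)

lemma flat_fun_has_derivative:
  "(flat_fun n has_real_derivative (flat_fun (n + 2) t - real n * flat_fun (n + 1) t)) (at t)"
proof -
  consider "t > 0" | "t < 0" | "t = 0" by linarith
  then show ?thesis
  proof cases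
    case 1
    have "((\<lambda>t. inverse t ^ n * exp (- inverse t)) has_real_derivative
        (real n * inverse t ^ (n - 1) * (- (inverse t * inverse t)) * exp (- inverse t) +
         inverse t ^ n * (exp (- inverse t) * (inverse t * inverse t)))) (at t)"
      using 1 by (auto intro!: derivative_eq_intros)
    moreover have "real n * inverse t ^ (n - 1) * (- (inverse t * inverse t)) * exp (- inverse t) +
        inverse t ^ n * (exp (- inverse t) * (inverse t * inverse t)) =
      flat_fun (n + 2) t - real n * flat_fun (n + 1) t"
      \<comment> \<open>The exponent \<open>n - 1\<close> is truncated at \<open>n = 0\<close>,
        where the factor \<open>real n\<close> removes the term.\<close>
      using 1 by (cases n) (simp_all add: flat_fun_def algebra_simps)
    ultimately have "((\<lambda>t. inverse t ^ n * exp (- inverse t)) has_real_derivative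
        (flat_fun (n + 2) t - real n * flat_fun (n + 1) t)) (at t)"
      by (simp only:)
    then show ?thesis
      by (rule has_field_derivative_transform_within_open[where S = "{0<..}"])
        (use 1 in \<open>auto simp: flat_fun_def\<close>)
  next
    case 2
    have "((\<lambda>t. 0) has_real_derivative (flat_fun (n + 2) t - real n * flat_fun (n + 1) t)) (at t)"
      using 2 by (simp add: flat_fun_def)
    then show ?thesis
      by (rule has_field_derivative_transform_within_open[where S = "{..<0}"])
        (use 2 in \<open>auto simp: flat_fun_def\<close>)
  next
    case 3
    \<comment> \<open>The quadratic bound makes the quotient at most a constant times \<bar>h\<bar>.
      The limit 0 is the claimed derivative, since every \<open>flat_fun\<close> vanishes at
      0.\<close>
    have "(\<lambda>h. (flat_fun n h - flat_fun n 0) / (h - 0)) \<midarrow>0\<rightarrow> 0"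
    proof (rule tendsto_rabs_zero_cancel, rule Lim_null_comparison)
      show "\<forall>\<^sub>F h in at 0. norm \<bar>(flat_fun n h - flat_fun n 0) / (h - 0)\<bar> \<le> fact (n + 2) * \<bar>h\<bar>"
      proof (intro always_eventually allI)
        fix h :: real
        show "norm \<bar>(flat_fun n h - flat_fun n 0) / (h - 0)\<bar> \<le> fact (n + 2) * \<bar>h\<bar>"
          using flat_fun_le[of n h] by (cases "h = 0") (auto simp: flat_fun_def[of n 0] divide_simps power2_eq_square)
      qed
      show "(\<lambda>h. fact (n + 2) * \<bar>h\<bar>) \<midarrow>0\<rightarrow> (0::real)"
        by (auto intro!: tendsto_eq_intros)
    qed
    then show ?thesis
      using 3 by (simp add: has_field_derivative_iff flat_fun_def[of _ 0])
  qed
qed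

lemma Ck_on_flat_fun: "Ck_on k (flat_fun n) UNIV"
proof (induction k arbitrary: n)
  case 0
  show ?case
    using DERIV_isCont[OF flat_fun_has_derivative]
    by (simp add: continuous_at_imp_continuous_on)
next
  case (Suc k)
  show ?case
  proof (rule Ck_on_Suc_has_derivativeI[OF open_UNIV])
    \<comment> \<open>The derivative is phrased with \<open>+\<close> and scaling only, to match the
      closure rules; the index rises, hence the induction over arbitrary \<open>n\<close>.\<close>
    show "(flat_fun n has_derivative
        (\<lambda>v. v *\<^sub>R (flat_fun (n + 2) x + (- real n) *\<^sub>R flat_fun (n + 1) x))) (at x)" for x
      using flat_fun_has_derivative[of n x]
      unfolding has_field_derivative_def
      by (rule has_derivative_eq_rhs) (simp add: fun_eq_iff)
    show "Ck_on k (\<lambda>x. v *\<^sub>R (flat_fun (n + 2) x + (- real n) *\<^sub>R flat_fun (n + 1) x)) UNIV" for v :: real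
      by (intro Ck_on_scaleR Ck_on_add Suc) simp_all
  qed
qed

lemma bump_function:
  fixes x0 :: "'e::euclidean_space"
  assumes "r > 0"
  shows "\<exists>f :: 'e \<Rightarrow> real. (\<forall>k S. open S \<longrightarrow> Ck_on k f S) \<and> f x0 = 1 \<and>
    (\<forall>x. x \<notin> cball x0 r \<longrightarrow> f x = 0)"
proof -
  \<comment> \<open>The squared distance is an inner product, hence smooth even at
    \<open>x0\<close>. \<open>?q\<close> is nonpositive outside the ball, where
    \<open>flat_fun 0\<close> vanishes, and the factor in \<open>?f\<close> normalises the value at
    \<open>x0\<close>, where \<open>?q\<close> is \<open>r\<^sup>2\<close>.\<close>
  let ?q = "\<lambda>x. r\<^sup>2 + (-1) *\<^sub>R ((x + - x0) \<bullet> (x + - x0))"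
  let ?f = "\<lambda>x. inverse (flat_fun 0 (r\<^sup>2)) *\<^sub>R flat_fun 0 (?q x)"
  have Ck: "Ck_on k ?f S" if "open S" for k S
  proof -
    have "Ck_on k ?q S"
      using that by (intro Ck_on_scaleR Ck_on_add Ck_on_inner Ck_on_id Ck_on_const)
    then have "Ck_on k (\<lambda>x. flat_fun 0 (?q x)) S"
      by (rule Ck_on_compose[OF that open_UNIV subset_UNIV Ck_on_flat_fun])
    then show ?thesis by (rule Ck_on_scaleR[OF that Ck_on_const])
  qed
  have one: "?f x0 = 1" using assms by (simp add: flat_fun_def)
  have zero: "?f x = 0" if "x \<notin> cball x0 r" for x
  proof -
    have "r < norm (x - x0)" using that by (simp add: dist_norm norm_minus_commute)
    then have "r\<^sup>2 \<le> (norm (x - x0))\<^sup>2" using assms by (intro power_mono) auto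
    then show ?thesis by (simp add: flat_fun_def power2_norm_eq_inner)
  qed
  show ?thesis
    by (rule exI[of _ ?f]) (intro conjI allI impI; rule Ck one zero; assumption)
qed

section \<open>Extension of tangent vectors\<close>

lemma exists_vector_field:
  fixes M :: "('m::{t2_space, second_countable_topology}, 'e::euclidean_space) manifold"
  assumes M: "smooth_manifold M"
  shows "\<exists>X\<in>vector_fields M. X q = v"
proof -
  have hom: "homeomorphism (chart_dom c) (chart_image c) (chart_map c) (chart_inv c)"
    and op: "open (chart_dom c)" "open (chart_image c)" if "c \<in> atlas M" for c
    using M that by (auto simp: smooth_manifold_def)
  have at: "chart_at M p \<in> atlas M" "p \<in> chart_dom (chart_at M p)" for p
    using M by (auto simp: smooth_manifold_def)
  have inv: "chart_inv c (chart_map c p) = p" if "c \<in> atlas M" "p \<in> chart_dom c" for c p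
    using hom[OF that(1)] that(2) by (simp add: homeomorphism_def)
  have open_image: "open (chart_map c ` (chart_dom c \<inter> W))" if "c \<in> atlas M" "open W" for c W
  proof -
    have "chart_map c ` (chart_dom c \<inter> W) = chart_image c \<inter> chart_inv c -` W"
      using inv[OF that(1)] by force
    moreover have "continuous_on (chart_image c) (chart_inv c)"
      using hom[OF that(1)] by (simp add: homeomorphism_def)
    ultimately show ?thesis
      using op[OF that(1)] that(2) by (simp add: continuous_open_preimage)
  qed
  have trans: "transition c d (chart_map c p) = chart_map d p"
    if "c \<in> atlas M" "p \<in> chart_dom c" for c d p
    using inv[OF that] by (simp add: transition_def)
  have Ck_trans: "Ck_on k (transition c d) (chart_map c ` (chart_dom c \<inter> chart_dom d))"
    if "c \<in> atlas M" "d \<in> atlas M" for c d k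
    using M that by (auto simp: smooth_manifold_def smooth_on_def)
  have deriv_trans: "(transition c d has_derivative
      frechet_derivative (transition c d) (at (chart_map c p))) (at (chart_map c p))"
    if "c \<in> atlas M" "d \<in> atlas M" "p \<in> chart_dom c" "p \<in> chart_dom d" for c d p
    by (rule Ck_on_Suc_has_derivative[OF open_image[OF that(1) op(1)[OF that(2)]] Ck_trans[OF that(1,2)]])
      (use that(3,4) in blast)
  \<comment> \<open>Cocycle rule for changes of components. The composite of transitions equals the
    direct one on the image of the overlap of \<open>a\<close> and \<open>b\<close>, an open set
    around the point, which suffices for derivatives.\<close>
  have chain: "frechet_derivative (transition b c) (at (chart_map b p))
        (frechet_derivative (transition a b) (at (chart_map a p)) w) =
      frechet_derivative (transition a c) (at (chart_map a p)) w"
    if "a \<in> atlas M" "b \<in> atlas M" "c \<in> atlas M"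
      "p \<in> chart_dom a" "p \<in> chart_dom b" "p \<in> chart_dom c" for a b c p w
  proof -
    have "((\<lambda>x. transition b c (transition a b x)) has_derivative
        (\<lambda>w. frechet_derivative (transition b c) (at (chart_map b p))
          (frechet_derivative (transition a b) (at (chart_map a p)) w))) (at (chart_map a p))"
      using deriv_trans[OF that(1,2,4,5)] deriv_trans[OF that(2,3,5,6)]
      unfolding trans[OF that(1,4), of b, symmetric] by (rule has_derivative_compose)
    then have "(transition a c has_derivative
        (\<lambda>w. frechet_derivative (transition b c) (at (chart_map b p))
          (frechet_derivative (transition a b) (at (chart_map a p)) w))) (at (chart_map a p))"
      by (rule has_derivative_transform_within_open
          [OF _ open_image[OF that(1) op(1)[OF that(2)]]])
        (use that in \<open>auto simp: trans\<close>)
    from fun_cong[OF frechet_derivative_at[OF this], of w] show ?thesis .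
  qed
  define d where "d = chart_at M q"
  have d: "d \<in> atlas M" "q \<in> chart_dom d" using at by (auto simp: d_def)
  then have "chart_map d q \<in> chart_image d" by blast
  then obtain r where r: "r > 0" "cball (chart_map d q) r \<subseteq> chart_image d"
    using op(2)[OF d(1)] unfolding open_contains_cball by blast
  obtain f :: "'e \<Rightarrow> real" where f: "\<And>k S. open S \<Longrightarrow> Ck_on k f S" "f (chart_map d q) = 1"
    "\<And>x. x \<notin> cball (chart_map d q) r \<Longrightarrow> f x = 0"
    using bump_function[OF r(1), of "chart_map d q"] by blast
  define C where "C = chart_inv d ` cball (chart_map d q) r"
  have "continuous_on (cball (chart_map d q) r) (chart_inv d)"
    using hom[OF d(1)] by (intro continuous_on_subset[OF _ r(2)]) (simp add: homeomorphism_def)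
  then have "closed C"
    unfolding C_def by (intro compact_imp_closed compact_continuous_image) auto
  then have C: "open (- C)" by auto
  \<comment> \<open>The field is \<open>f\<close> times the constant \<open>v\<close> in chart
    \<open>d\<close>, converted at each \<open>p\<close> to the preferred chart there. By
    \<open>chain\<close>, its components in a fixed chart \<open>c\<close> involve only the
    transition from \<open>d\<close> to \<open>c\<close>, so the jumps of \<open>chart_at\<close>
    disappear.\<close>
  define X where "X p = (if p \<in> chart_dom d then f (chart_map d p) *\<^sub>R
    frechet_derivative (transition d (chart_at M p)) (at (chart_map d p)) v else 0)" for p
  have X0: "X p = 0" if "p \<notin> C" for p
  proof (cases "p \<in> chart_dom d")
    case True
    then have "chart_map d p \<notin> cball (chart_map d q) r"
      using that imageI[of "chart_map d p" _ "chart_inv d"] unfolding C_def inv[OF d(1) True] by blast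
    then show ?thesis by (simp add: X_def f(3))
  qed (simp add: X_def)
  have "Ck_on k (local_rep M c X) (chart_image c)" if c: "c \<in> atlas M" for c k
  proof -
    let ?U = "chart_map c ` (chart_dom c \<inter> chart_dom d)" and ?V = "chart_map c ` (chart_dom c \<inter> - C)"
    let ?T = "chart_map d ` (chart_dom d \<inter> chart_dom c)"
    have U: "open ?U" and V: "open ?V" and T: "open ?T"
      using open_image c d(1) C op by auto
    \<comment> \<open>Linearity lets the cut-off factor be pulled out on \<open>?U\<close> and sends
      the zero vector to zero on \<open>?V\<close>.\<close>
    have lin: "linear (components_in M c p)" if "p \<in> chart_dom c" for p
      using has_derivative_linear[OF deriv_trans[OF at(1) c at(2) that]]
      unfolding components_in_def[abs_def] by simp
    have "Ck_on k (\<lambda>x. f (transition c d x) *\<^sub>R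
        frechet_derivative (transition d c) (at (transition c d x)) v) ?U"
    proof (intro Ck_on_scaleR U)
      have sub: "transition c d ` ?U \<subseteq> ?T" using c by (auto simp: trans)
      show "Ck_on k (\<lambda>x. f (transition c d x)) ?U"
        by (rule Ck_on_compose[OF U T sub]) (use f(1) T Ck_trans c d in auto)
      \<comment> \<open>Differentiating the transition costs one order, so it is taken at order
        \<open>Suc k\<close>.\<close>
      have "Ck_on k (\<lambda>y. frechet_derivative (transition d c) (at y) v) ?T"
        using Ck_trans[OF d(1) c, of "Suc k"] by simp
      then show "Ck_on k (\<lambda>x. frechet_derivative (transition d c) (at (transition c d x)) v) ?U"
        by (rule Ck_on_compose[OF U T sub]) (use Ck_trans c d in auto)
    qed
    then have CU: "Ck_on k (local_rep M c X) ?U"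
    proof (rule Ck_on_cong[OF U, rotated])
      fix x assume "x \<in> ?U"
      then obtain p where p: "p \<in> chart_dom c" "p \<in> chart_dom d" "x = chart_map c p" by auto
      show "f (transition c d x) *\<^sub>R frechet_derivative (transition d c) (at (transition c d x)) v
          = local_rep M c X x"
      proof -
        have "local_rep M c X x = components_in M c p (X p)"
          using p(3) inv[OF c p(1)] by (simp add: local_rep_def)
        also have "\<dots> = f (chart_map d p) *\<^sub>R components_in M c p
            (frechet_derivative (transition d (chart_at M p)) (at (chart_map d p)) v)"
          using p(2) linear_scale[OF lin[OF p(1)]] by (simp add: X_def)
        also have "\<dots> = f (chart_map d p) *\<^sub>R
            frechet_derivative (transition d c) (at (chart_map d p)) v"
          unfolding components_in_def by (subst chain) (use p c d(1) at[of p] in auto)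
        finally show ?thesis
          using p(3) trans[OF c p(1)] by simp
      qed
    qed
    have CV: "Ck_on k (local_rep M c X) ?V"
    proof (rule Ck_on_cong[OF V, rotated])
      show "Ck_on k (\<lambda>x. 0) ?V" by simp
      fix x assume "x \<in> ?V"
      then show "0 = local_rep M c X x"
        using c linear_0[OF lin] by (auto simp: local_rep_def inv X0)
    qed
    \<comment> \<open>Hence \<open>chart_dom d\<close> and the complement of \<open>C\<close> cover
      the manifold, and \<open>?U\<close> and \<open>?V\<close> cover the image of
      \<open>c\<close>.\<close>
    have "C \<subseteq> chart_dom d"
    proof
      fix p assume "p \<in> C"
      then obtain p' where "p' \<in> chart_dom d" "p = chart_inv d (chart_map d p')"
        using r(2) unfolding C_def by blast
      then show "p \<in> chart_dom d" using inv[OF d(1)] by simp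
    qed
    then have "chart_image c = ?U \<union> ?V" by auto
    then show ?thesis using Ck_on_Un[OF U V CU CV] by simp
  qed
  then have "X \<in> vector_fields M" by (simp add: vector_fields_def smooth_on_def)
  moreover have "X q = v"
  proof -
    \<comment> \<open>Since \<open>d\<close> is the preferred chart at \<open>q\<close>, the
      conversion there is the derivative of the identity.\<close>
    have "((\<lambda>x. x) has_derivative (\<lambda>x. x)) (at (chart_map d q))" by simp
    then have "(transition d d has_derivative (\<lambda>x. x)) (at (chart_map d q))"
      by (rule has_derivative_transform_within_open[OF _ op(2)[OF d(1)]])
        (use d in \<open>auto simp: trans\<close>)
    from fun_cong[OF frechet_derivative_at[OF this], of v] show ?thesis
      using d(2) f(2) by (simp add: X_def flip: d_def)
  qed
  ultimately show ?thesis by blast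
qed

text \<open>\<open>exists_vector_field\<close> makes the choice in \<open>endo_at\<close>
  legitimate, and the premise on \<open>F\<close> makes the result independent of the extension
  chosen.\<close>

lemma endo_at_eq:
  fixes M :: "('m::{t2_space, second_countable_topology}, 'e::euclidean_space) manifold"
  assumes "smooth_manifold M" and "\<And>X. X \<in> vector_fields M \<Longrightarrow> F X p = L (X p)"
  shows "endo_at M F p = L"
proof
  fix v
  have "(SOME X. X \<in> vector_fields M \<and> X p = v) \<in> vector_fields M \<and>
      (SOME X. X \<in> vector_fields M \<and> X p = v) p = v"
    by (rule someI_ex[OF exists_vector_field[OF assms(1), of p v, unfolded Bex_def]])
  then show "endo_at M F p v = L v" by (simp add: endo_at_def assms(2))
qed

section \<open>Traces\<close>

lemma endo_trace_add: "endo_trace (\<lambda>x. A x + B x) = endo_trace A + endo_trace B"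
  by (simp add: endo_trace_def inner_add_left sum.distrib)

lemma endo_trace_diff: "endo_trace (\<lambda>x. A x - B x) = endo_trace A - endo_trace B"
  by (simp add: endo_trace_def inner_diff_left sum_subtractf)

lemma endo_trace_scaleR: "endo_trace (\<lambda>x. a *\<^sub>R A x) = a * endo_trace A"
  by (simp add: endo_trace_def sum_distrib_left)

lemma endo_trace_ident: "endo_trace (\<lambda>x::'e::euclidean_space. x) = DIM('e)"
  by (simp add: endo_trace_def)

lemma endo_trace_rank_one:
  assumes "linear f"
  shows "endo_trace (\<lambda>x. f x *\<^sub>R w) = f w"
proof -
  have "f w = f (\<Sum>b\<in>Basis. (w \<bullet> b) *\<^sub>R b)" by (simp only: euclidean_representation)
  also have "\<dots> = (\<Sum>b\<in>Basis. (w \<bullet> b) * f b)"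
    by (simp add: linear_sum[OF assms] linear_scale[OF assms])
  finally show ?thesis by (simp add: endo_trace_def mult.commute)
qed

text \<open>Both traces expand into the same double sum of products of matrix entries, with the
  order of summation exchanged.\<close>

lemma endo_trace_commute:
  fixes A B :: "'e::euclidean_space \<Rightarrow> 'e"
  assumes "linear A" "linear B"
  shows "endo_trace (\<lambda>x. A (B x)) = endo_trace (\<lambda>x. B (A x))"
proof -
  have expand: "endo_trace (\<lambda>x. f (g x)) = (\<Sum>b\<in>Basis. \<Sum>c\<in>Basis. (g b \<bullet> c) * (f c \<bullet> b))"
    if "linear f" for f g :: "'e \<Rightarrow> 'e"
    unfolding endo_trace_def
  proof (rule sum.cong[OF refl])
    fix b
    have "f (g b) = f (\<Sum>c\<in>Basis. (g b \<bullet> c) *\<^sub>R c)"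
      by (simp only: euclidean_representation)
    also have "\<dots> = (\<Sum>c\<in>Basis. (g b \<bullet> c) *\<^sub>R f c)"
      by (simp only: linear_sum[OF that] linear_scale[OF that])
    finally have "f (g b) \<bullet> b = (\<Sum>c\<in>Basis. (g b \<bullet> c) *\<^sub>R f c) \<bullet> b"
      by (rule arg_cong)
    then show "f (g b) \<bullet> b = (\<Sum>c\<in>Basis. (g b \<bullet> c) * (f c \<bullet> b))"
      by (simp only: inner_sum_left inner_scaleR_left)
  qed
  have "endo_trace (\<lambda>x. A (B x)) = (\<Sum>b\<in>Basis. \<Sum>c\<in>Basis. (B b \<bullet> c) * (A c \<bullet> b))"
    by (rule expand[OF assms(1)])
  also have "\<dots> = (\<Sum>c\<in>Basis. \<Sum>b\<in>Basis. (A c \<bullet> b) * (B b \<bullet> c))"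
    by (subst sum.swap) (simp only: mult.commute)
  also have "\<dots> = endo_trace (\<lambda>x. B (A x))"
    by (rule expand[OF assms(2), symmetric])
  finally show ?thesis .
qed

lemma endo_trace_adjoint:
  fixes A :: "'e::euclidean_space \<Rightarrow> 'e"
  assumes "linear A"
  shows "endo_trace (adjoint A) = endo_trace A"
  unfolding endo_trace_def
  by (simp only: inner_commute[of "adjoint A b" b for b] adjoint_works[OF assms])

text \<open>
  If \<open>G\<close> represents \<open>g\<close>, skewness reads \<open>G A = - A\<^sup>T G\<close>, so \<open>A\<close> is similar to \<open>- A\<^sup>T\<close>.
\<close>

lemma endo_trace_skew:
  fixes A :: "'e::euclidean_space \<Rightarrow> 'e" and g :: "'e \<Rightarrow> 'e \<Rightarrow> real"
  assumes "linear A" and "bilinear g" and pos: "\<And>u. u \<noteq> 0 \<Longrightarrow> g u u > 0"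
    and skew: "\<And>u v. g (A u) v = - g u (A v)"
  shows "endo_trace A = 0"
proof -
  define G where "G u = (\<Sum>b\<in>Basis. g u b *\<^sub>R b)" for u
  have G: "G u \<bullet> v = g u v" for u v
  proof -
    have lin: "linear (g u)" using assms(2) by (simp add: bilinear_def)
    have "g u v = g u (\<Sum>b\<in>Basis. (v \<bullet> b) *\<^sub>R b)" by (simp only: euclidean_representation)
    also have "\<dots> = (\<Sum>b\<in>Basis. (v \<bullet> b) * g u b)"
      by (simp add: linear_sum[OF lin] linear_scale[OF lin])
    finally show ?thesis
      unfolding G_def inner_sum_left inner_scaleR_left
      by (simp only: inner_commute mult.commute)
  qed
  have linG: "linear G"
    by (rule linearI; rule vector_eq_rdot[THEN iffD1])
      (auto simp: G inner_add_left assms(2) bilinear_ladd bilinear_lmul)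
  \<comment> \<open>Positivity makes the Gram operator \<open>G\<close> injective, hence invertible
    in finite dimension, with inverse \<open>H\<close>.\<close>
  have "inj G"
    unfolding linear_injective_0[OF linG]
  proof (intro allI impI)
    fix u assume "G u = 0"
    then have "g u u = 0" using G[of u u] by simp
    then show "u = 0" using pos[of u] by (cases "u = 0") auto
  qed
  then obtain H where H: "linear H" "\<And>x. H (G x) = x" "\<And>x. G (H x) = x"
    using linear_injective_isomorphism[OF linG] by metis
  have GA: "G (A x) = - adjoint A (G x)" for x
    by (rule vector_eq_rdot[THEN iffD1])
      (simp add: G skew adjoint_clauses[OF assms(1)])
  have lin: "linear (\<lambda>x. - adjoint A (G x))"
    using linear_compose[OF linG linear_compose[OF adjoint_linear[OF assms(1)] linear_uminus]]
    by (simp add: o_def)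
  \<comment> \<open>\<open>A\<close> is \<open>H\<close> after minus the adjoint after
    \<open>G\<close>. Moving \<open>H\<close> to the other side cancels \<open>G\<close>, and the
    adjoint has the trace of \<open>A\<close>, so the trace equals its own negative.\<close>
  have "endo_trace A = endo_trace (\<lambda>x. H (- adjoint A (G x)))"
    by (simp flip: GA add: H)
  also have "\<dots> = endo_trace (\<lambda>x. - adjoint A x)"
    by (subst endo_trace_commute[OF H(1) lin]) (simp add: H)
  also have "\<dots> = - endo_trace A"
    using endo_trace_adjoint[OF assms(1)] by (simp add: endo_trace_def sum_negf)
  finally show ?thesis by simp
qed

section \<open>The Ricci tensor\<close>

text \<open>Compatibility gives \<phi>\<xi> squared length \<open>1 - 1 = 0\<close>, so \<phi>\<xi>
  = 0. Then compute the cube of \<phi> at \<open>u\<close> twice: applying \<phi> to the square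
  gives -\<phi>u, while squaring at \<phi>u adds \<eta>(\<phi>u)\<xi>, which must vanish.\<close>

lemma almost_contact_metric_eta_phi:
  assumes "almost_contact_metric_manifold M g \<phi> \<xi>"
  shows "g p (\<phi> p u) (\<xi> p) = 0"
proof -
  have bil: "bilinear (g p)" and pos: "\<And>u. u \<noteq> 0 \<Longrightarrow> g p u u > 0" and lin: "linear (\<phi> p)"
    and norm: "g p (\<xi> p) (\<xi> p) = 1"
    and sq: "\<And>u. \<phi> p (\<phi> p u) = - u + g p u (\<xi> p) *\<^sub>R \<xi> p"
    and iso: "\<And>u v. g p (\<phi> p u) (\<phi> p v) = g p u v - g p u (\<xi> p) * g p v (\<xi> p)"
    using assms by (auto simp: almost_contact_metric_manifold_def riemannian_manifold_def
        endomorphism_field_def)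
  have "g p (\<phi> p (\<xi> p)) (\<phi> p (\<xi> p)) = 0" by (simp add: iso norm)
  then have phi_xi: "\<phi> p (\<xi> p) = 0" using pos by fastforce
  have "\<phi> p (\<phi> p (\<phi> p u)) = - \<phi> p u"
    by (simp add: sq phi_xi linear_diff[OF lin] linear_scale[OF lin])
  then have "g p (\<phi> p u) (\<xi> p) *\<^sub>R \<xi> p = 0" by (simp add: sq[of "\<phi> p u"])
  then show ?thesis using norm bilinear_lzero[OF bil] by auto
qed

lemma ricci_constant_phi_sectional_curvature:
  fixes M :: "('m::{t2_space, second_countable_topology}, 'e::euclidean_space) manifold"
  assumes M: "almost_contact_metric_manifold M g \<phi> \<xi>"
    and c: "constant_phi_sectional_curvature M D K g \<phi> \<xi> c"
    and YZ: "Y \<in> vector_fields M" "Z \<in> vector_fields M"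
  shows "ricci M D K Y Z p =
    ((c - 3) * (real DIM('e) - 1) + 2 * (c + 1)) / 4 * g p (Y p) (Z p) -
    (c + 1) * (real DIM('e) + 1) / 4 * (g p (Y p) (\<xi> p) * g p (Z p) (\<xi> p))"
proof -
  have sm: "smooth_manifold M" and bil: "bilinear (g p)" and sym: "\<And>u v. g p u v = g p v u"
    and pos: "\<And>u. u \<noteq> 0 \<Longrightarrow> g p u u > 0" and lin: "linear (\<phi> p)"
    and norm: "g p (\<xi> p) (\<xi> p) = 1"
    and sq: "\<And>u. \<phi> p (\<phi> p u) = - u + g p u (\<xi> p) *\<^sub>R \<xi> p"
    and iso: "\<And>u v. g p (\<phi> p u) (\<phi> p v) = g p u v - g p u (\<xi> p) * g p v (\<xi> p)"
    using M by (auto simp: almost_contact_metric_manifold_def riemannian_manifold_def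
        endomorphism_field_def)
  note bil_simps = bilinear_ladd[OF bil] bilinear_radd[OF bil] bilinear_lmul[OF bil]
    bilinear_rmul[OF bil] bilinear_lneg[OF bil] bilinear_rneg[OF bil]
  have eta_phi: "g p (\<phi> p u) (\<xi> p) = 0" for u
    using M by (rule almost_contact_metric_eta_phi)
  \<comment> \<open>Compatibility applied to \<open>u\<close> and \<phi>v; both \<eta> terms drop
    out by \<open>eta_phi\<close>.\<close>
  have skew: "g p (\<phi> p u) v = - g p u (\<phi> p v)" for u v
    using iso[of u "\<phi> p v"] by (simp add: sq bil_simps bilinear_rsub[OF bil] eta_phi)
  have tr_phi: "endo_trace (\<phi> p) = 0" by (rule endo_trace_skew[OF lin bil pos skew])
  have l1: "linear (\<lambda>x. g p x w)" for w using bil by (simp add: bilinear_def)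
  have l2: "linear (\<lambda>x. g p (\<phi> p x) w)" for w
    using linear_compose[OF lin l1] by (simp add: o_def)
  \<comment> \<open>The curvature formula as a function of its first argument, with scalars nested
    so that each rank-one term is a constant times \<open>f x *\<^sub>R w\<close>, the shape that
    the trace rules match.\<close>
  let ?L = "\<lambda>x. ((c - 3) / 4) *\<^sub>R (g p (Y p) (Z p) *\<^sub>R x - g p x (Z p) *\<^sub>R Y p) +
          ((c + 1) / 4) *\<^sub>R
            (g p (\<phi> p (Y p)) (Z p) *\<^sub>R \<phi> p x
             - g p (\<phi> p x) (Z p) *\<^sub>R \<phi> p (Y p)
             - 2 *\<^sub>R g p (\<phi> p x) (Y p) *\<^sub>R \<phi> p (Z p)
             - (g p (Y p) (\<xi> p) * g p (Z p) (\<xi> p)) *\<^sub>R x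
             + g p (Z p) (\<xi> p) *\<^sub>R g p x (\<xi> p) *\<^sub>R Y p
             + g p (Y p) (\<xi> p) *\<^sub>R g p x (Z p) *\<^sub>R \<xi> p
             - g p (Z p) (Y p) *\<^sub>R g p x (\<xi> p) *\<^sub>R \<xi> p)"
  have "endo_at M (\<lambda>X. statistical_curvature M D K X Y Z) p = ?L"
  proof (rule endo_at_eq[OF sm])
    fix X assume "X \<in> vector_fields M"
    then have eq: "statistical_curvature M D K X Y Z p =
        ((c - 3) / 4) *\<^sub>R (g p (Y p) (Z p) *\<^sub>R X p - g p (X p) (Z p) *\<^sub>R Y p) +
        ((c + 1) / 4) *\<^sub>R
          (g p (\<phi> p (Y p)) (Z p) *\<^sub>R \<phi> p (X p)
           - g p (\<phi> p (X p)) (Z p) *\<^sub>R \<phi> p (Y p)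
           - (2 * g p (\<phi> p (X p)) (Y p)) *\<^sub>R \<phi> p (Z p)
           - (g p (Y p) (\<xi> p) * g p (Z p) (\<xi> p)) *\<^sub>R X p
           + (g p (X p) (\<xi> p) * g p (Z p) (\<xi> p)) *\<^sub>R Y p
           + (g p (Y p) (\<xi> p) * g p (Z p) (X p)) *\<^sub>R \<xi> p
           - (g p (X p) (\<xi> p) * g p (Z p) (Y p)) *\<^sub>R \<xi> p)"
      using c YZ unfolding constant_phi_sectional_curvature_def by blast
    show "statistical_curvature M D K X Y Z p = ?L (X p)"
      unfolding eq scaleR_scaleR sym[of "Z p" "X p"] by (simp only: mult.commute)
  qed
  then have "ricci M D K Y Z p = endo_trace ?L"
    by (simp only: ricci_def)
  also have "\<dots> = (c - 3) / 4 * (g p (Y p) (Z p) * real DIM('e) - g p (Y p) (Z p)) +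
      (c + 1) / 4 * (g p (\<phi> p (Y p)) (Z p) * endo_trace (\<phi> p) - g p (\<phi> p (\<phi> p (Y p))) (Z p)
        - 2 * g p (\<phi> p (\<phi> p (Z p))) (Y p)
        - (g p (Y p) (\<xi> p) * g p (Z p) (\<xi> p)) * real DIM('e)
        + g p (Z p) (\<xi> p) * g p (Y p) (\<xi> p) + g p (Y p) (\<xi> p) * g p (\<xi> p) (Z p)
        - g p (Z p) (Y p) * g p (\<xi> p) (\<xi> p))"
    by (simp only: endo_trace_add endo_trace_diff endo_trace_scaleR endo_trace_ident
        endo_trace_rank_one[OF l1] endo_trace_rank_one[OF l2])
  also have "\<dots> = ((c - 3) * (real DIM('e) - 1) + 2 * (c + 1)) / 4 * g p (Y p) (Z p) -
      (c + 1) * (real DIM('e) + 1) / 4 * (g p (Y p) (\<xi> p) * g p (Z p) (\<xi> p))"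
  proof -
    \<comment> \<open>With n the dimension, the bracket after \<open>(c + 1) / 4\<close> collapses
      to 2 g(Y,Z) - (n + 1) \<eta>(Y) \<eta>(Z): the \<phi> terms give 3 g - 3 \<eta>\<eta>, and the
      rest -g - (n - 2) \<eta>\<eta>.\<close>
    have phi2: "g p (\<phi> p (\<phi> p (Y p))) (Z p) = - g p (Y p) (Z p) + g p (Y p) (\<xi> p) * g p (Z p) (\<xi> p)"
      "g p (\<phi> p (\<phi> p (Z p))) (Y p) = - g p (Y p) (Z p) + g p (Y p) (\<xi> p) * g p (Z p) (\<xi> p)"
      unfolding sq bil_simps sym[of "\<xi> p" "Z p"] sym[of "\<xi> p" "Y p"] sym[of "Z p" "Y p"]
      by simp_all
    show ?thesis
      unfolding phi2 tr_phi norm sym[of "\<xi> p" "Z p"] sym[of "Z p" "Y p"]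
      by (simp add: field_simps)
  qed
  finally show ?thesis .
qed

theorem proposition3p12:
  fixes B :: "('m::{t2_space, second_countable_topology}, 'e::euclidean_space) manifold"
    and gt :: "'m \<Rightarrow> 'e \<Rightarrow> 'e \<Rightarrow> real" and J :: "'m \<Rightarrow> 'e \<Rightarrow> 'e"
    and Dt :: "('m \<Rightarrow> 'e) \<Rightarrow> ('m \<Rightarrow> 'e) \<Rightarrow> 'm \<Rightarrow> 'e" and K :: "'m \<Rightarrow> 'e \<Rightarrow> 'e \<Rightarrow> 'e"
    and Bb :: "('m \<times> real, 'e \<times> real) manifold"
    and gb :: "'m \<times> real \<Rightarrow> 'e \<times> real \<Rightarrow> 'e \<times> real \<Rightarrow> real"
    and \<phi> :: "'m \<times> real \<Rightarrow> 'e \<times> real \<Rightarrow> 'e \<times> real" and \<xi> :: "'m \<times> real \<Rightarrow> 'e \<times> real"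
    and Db :: "('m \<times> real \<Rightarrow> 'e \<times> real) \<Rightarrow> ('m \<times> real \<Rightarrow> 'e \<times> real) \<Rightarrow> 'm \<times> real \<Rightarrow> 'e \<times> real"
    and Kb :: "'m \<times> real \<Rightarrow> 'e \<times> real \<Rightarrow> 'e \<times> real \<Rightarrow> 'e \<times> real"
    and \<beta> :: "'m \<times> real \<Rightarrow> real" and c t1 t2 :: real and s :: nat
  assumes "holomorphic_statistical_manifold B Dt K gt J"
    and "s \<ge> 1" and "DIM('e) = 2 * s" and "DIM('e \<times> real) = 2 * s + 1"
    and "Bb = times_line B" and "gb = warped_metric gt" and "\<xi> = line_field" and "\<phi> = extend_endo J"
    and "kenmotsu_statistical_manifold Bb Db Kb gb \<phi> \<xi>"
    and "\<forall>p u v. K p u v = 0"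
    and "\<beta> \<in> smooth_functions Bb"
    and "\<forall>q u v. Kb q u v = (\<beta> q * gb q u (\<xi> q) * gb q v (\<xi> q)) *\<^sub>R \<xi> q"
    and "constant_phi_sectional_curvature Bb Db Kb gb \<phi> \<xi> c"
    and "t1 = (c * (real s + 1) - 3 * real s + 1) / 2"
    and "t2 = (- (c + 1) * (real s + 1)) / 2"
  shows "((\<forall>X\<in>vector_fields Bb. \<forall>Y\<in>vector_fields Bb. \<forall>q.
            ricci Bb Db Kb X Y q =
              t1 * gb q (X q) (Y q) + t2 * gb q (X q) (\<xi> q) * gb q (Y q) (\<xi> q)) \<and>
          \<not> ricci_flat Bb Db Kb) \<and>
         (\<forall>X\<in>vector_fields Bb. \<forall>q.
            ricci Bb Db Kb X \<xi> q = - 2 * real s * gb q (X q) (\<xi> q)) \<and>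
         (\<forall>X\<in>vector_fields Bb. \<forall>Y\<in>vector_fields Bb. \<forall>q.
            ricci Bb Db Kb (app1 \<phi> X) (app1 \<phi> Y) q =
              ricci Bb Db Kb X Y q + 2 * real s * gb q (X q) (\<xi> q) * gb q (Y q) (\<xi> q))"
proof -
  note kenmotsu = \<open>kenmotsu_statistical_manifold Bb Db Kb gb \<phi> \<xi>\<close>
  then have contact: "almost_contact_metric_manifold Bb gb \<phi> \<xi>"
    by (simp add: kenmotsu_statistical_manifold_def kenmotsu_manifold_def)
  then have xi: "\<xi> \<in> vector_fields Bb" and norm: "\<And>q. gb q (\<xi> q) (\<xi> q) = 1"
    and phi: "\<And>X. X \<in> vector_fields Bb \<Longrightarrow> app1 \<phi> X \<in> vector_fields Bb"
    and iso: "\<And>q u v. gb q (\<phi> q u) (\<phi> q v) = gb q u v - gb q u (\<xi> q) * gb q v (\<xi> q)"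
    by (auto simp: almost_contact_metric_manifold_def endomorphism_field_def)
  have eta_phi: "gb q (\<phi> q u) (\<xi> q) = 0" for q u
    using contact by (rule almost_contact_metric_eta_phi)
  have dim: "real DIM('e \<times> real) = 2 * real s + 1" using assms(4) by simp
  have ricci: "ricci Bb Db Kb X Y q =
      t1 * gb q (X q) (Y q) + t2 * gb q (X q) (\<xi> q) * gb q (Y q) (\<xi> q)"
    if "X \<in> vector_fields Bb" "Y \<in> vector_fields Bb" for X Y q
    unfolding ricci_constant_phi_sectional_curvature[OF contact assms(13) that] dim
    by (simp add: assms(14,15) field_simps)
  have sum: "t1 + t2 = - 2 * real s" by (simp add: assms(14,15) field_simps)
  have ricci_xi: "ricci Bb Db Kb X \<xi> q = - 2 * real s * gb q (X q) (\<xi> q)"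
    if "X \<in> vector_fields Bb" for X q
    unfolding ricci[OF that xi] sum[symmetric] by (simp add: norm algebra_simps)
  have t2: "t2 = - 2 * real s - t1" using sum by simp
  \<comment> \<open>The Reeb field itself witnesses non-flatness: its Ricci value is -2s, nonzero
    because \<open>s \<ge> 1\<close>.\<close>
  have "ricci Bb Db Kb \<xi> \<xi> q \<noteq> 0" for q
    using ricci_xi[OF xi, of q] norm \<open>s \<ge> 1\<close> by simp
  then have "\<not> ricci_flat Bb Db Kb" unfolding ricci_flat_def using xi by blast
  \<comment> \<open>The \<eta> terms vanish on images of \<phi>, leaving \<open>t1\<close> times (g
    - \<eta>\<eta>). This exceeds the original Ricci value by -(t1 + t2) \<eta>\<eta> = 2s
    \<eta>\<eta>.\<close>
  moreover have "ricci Bb Db Kb (app1 \<phi> X) (app1 \<phi> Y) q =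
      ricci Bb Db Kb X Y q + 2 * real s * gb q (X q) (\<xi> q) * gb q (Y q) (\<xi> q)"
    if "X \<in> vector_fields Bb" "Y \<in> vector_fields Bb" for X Y q
    unfolding ricci[OF that] ricci[OF phi[OF that(1)] phi[OF that(2)]]
    by (simp add: app1_def iso eta_phi t2 algebra_simps)
  ultimately show ?thesis using ricci ricci_xi by blast
qed

end
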